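(* If $\Phi$ is a $C^1$ flow on an odd-dimensional connected compact $C^1$ manifold $X$ with at least one isolated equilibrium, then $(X,\Phi)$ is not linearizable by a $C^1$ embedding.
   Context: Manifolds are, as usual, finite-dimensional, Hausdorff, second countable and without boundary. A flow on $X$ is a group action $\Phi\colon \mathbb{R}\times X\to X$, $(t,x)\mapsto \Phi^t(x)$, of $(\mathbb{R},+)$ on $X$; it is $C^1$ if $\Phi$ is a $C^1$ map. An equilibrium of $\Phi$ is a point fixed by all $\Phi^t$, and it is isolated if it is an isolated point of the set of equilibria. A map $F\colon X\to\mathbb{R}^n$ is linearizing (for $\Phi$) if there is a matrix $B\in\mathbb{R}^{n\times n}$ such that $F\circ\Phi^t=e^{Bt}\circ F$ for all $t\in\mathbb{R}$. A $C^1$ embedding is a $C^1$ map that is both an immersion and a homeomorphism onto its image. $(X,\Phi)$ is linearizable by a $C^1$ embedding if for some $n\in\mathbb{N}$ there is a linearizing $C^1$ embedding $F\colon X\to\mathbb{R}^n$. *)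

theory Defs
  imports "HOL-Analysis.Analysis" "Jordan_Normal_Form.Matrix"
begin

text \<open>
  A manifold is given by a topology on a subset of a type and a \<open>C\<^sup>1\<close> atlas, which need not be
  maximal. The model space is a type, \<open>real ^ 'n\<close> for a manifold of dimension \<open>CARD('n)\<close>; other
  normed spaces serve as models for \<open>\<real>\<close> and for the product \<open>\<real> \<times> X\<close>. A chart is its domain
  together with the coordinate map.
\<close>

type_synonym ('a, 'e) chart = "'a set \<times> ('a \<Rightarrow> 'e)"

text \<open>Meant for open \<open>S\<close>, where \<open>at p\<close> and \<open>at p within S\<close> agree.\<close>

definition C1_on :: "'e set \<Rightarrow> ('e::real_normed_vector \<Rightarrow> 'f::real_normed_vector) \<Rightarrow> bool" where
  "C1_on S f \<longleftrightarrow> (\<exists>f' :: 'e \<Rightarrow> 'e \<Rightarrow>\<^sub>L 'f.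
     (\<forall>p\<in>S. (f has_derivative blinfun_apply (f' p)) (at p)) \<and> continuous_on S f')"

definition is_chart :: "'a topology \<Rightarrow> ('a, 'e::real_normed_vector) chart \<Rightarrow> bool" where
  "is_chart X = (\<lambda>(U, \<phi>). openin X U \<and> open (\<phi> ` U) \<and>
     homeomorphic_map (subtopology X U) (top_of_set (\<phi> ` U)) \<phi>)"

definition C1_atlas :: "'a topology \<Rightarrow> ('a, 'e::real_normed_vector) chart set \<Rightarrow> bool" where
  "C1_atlas X A \<longleftrightarrow>
     (\<forall>c\<in>A. is_chart X c) \<and>
     (\<Union>(U, \<phi>)\<in>A. U) = topspace X \<and>
     (\<forall>(U, \<phi>)\<in>A. \<forall>(V, \<psi>)\<in>A. C1_on (\<phi> ` (U \<inter> V)) (\<psi> \<circ> inv_into U \<phi>))"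

definition C1_manifold :: "'a topology \<Rightarrow> ('a, 'e::euclidean_space) chart set \<Rightarrow> bool" where
  "C1_manifold X A \<longleftrightarrow> Hausdorff_space X \<and> second_countable X \<and> C1_atlas X A"

definition C1_map :: "'a topology \<Rightarrow> ('a, 'e::real_normed_vector) chart set \<Rightarrow>
    'b topology \<Rightarrow> ('b, 'f::real_normed_vector) chart set \<Rightarrow> ('a \<Rightarrow> 'b) \<Rightarrow> bool" where
  "C1_map X A Y B f \<longleftrightarrow>
     continuous_map X Y f \<and>
     (\<forall>(U, \<phi>)\<in>A. \<forall>(V, \<psi>)\<in>B. C1_on (\<phi> ` {x \<in> U. f x \<in> V}) (\<psi> \<circ> f \<circ> inv_into U \<phi>))"

definition real_atlas :: "(real, real) chart set" where
  "real_atlas = {(UNIV, id)}"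

definition prod_atlas :: "('a, 'e) chart set \<Rightarrow> ('b, 'f) chart set \<Rightarrow> ('a \<times> 'b, 'e \<times> 'f) chart set" where
  "prod_atlas A B = {(U \<times> V, map_prod \<phi> \<psi>) | U \<phi> V \<psi>. (U, \<phi>) \<in> A \<and> (V, \<psi>) \<in> B}"

definition flow_on :: "'a set \<Rightarrow> (real \<Rightarrow> 'a \<Rightarrow> 'a) \<Rightarrow> bool" where
  "flow_on S \<Phi> \<longleftrightarrow>
     (\<forall>t. \<forall>x\<in>S. \<Phi> t x \<in> S) \<and>
     (\<forall>x\<in>S. \<Phi> 0 x = x) \<and>
     (\<forall>s t. \<forall>x\<in>S. \<Phi> (s + t) x = \<Phi> s (\<Phi> t x))"

definition C1_flow :: "'a topology \<Rightarrow> ('a, 'e::real_normed_vector) chart set \<Rightarrow>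
    (real \<Rightarrow> 'a \<Rightarrow> 'a) \<Rightarrow> bool" where
  "C1_flow X A \<Phi> \<longleftrightarrow>
     flow_on (topspace X) \<Phi> \<and>
     C1_map (prod_topology euclideanreal X) (prod_atlas real_atlas A) X A (\<lambda>(t, x). \<Phi> t x)"

definition equilibria :: "'a topology \<Rightarrow> (real \<Rightarrow> 'a \<Rightarrow> 'a) \<Rightarrow> 'a set" where
  "equilibria X \<Phi> = {x \<in> topspace X. \<forall>t. \<Phi> t x = x}"

definition isolated_equilibrium :: "'a topology \<Rightarrow> (real \<Rightarrow> 'a \<Rightarrow> 'a) \<Rightarrow> 'a \<Rightarrow> bool" where
  "isolated_equilibrium X \<Phi> x \<longleftrightarrow>
     x \<in> equilibria X \<Phi> \<and> (\<exists>U. openin X U \<and> U \<inter> equilibria X \<Phi> = {x})"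

text \<open>
  The dimension \<open>n\<close> of the target space is quantified inside the definition of linearizability, so
  the target is the carrier \<open>Euclidean_space n\<close> (real sequences vanishing from index \<open>n\<close> on)
  rather than a type; \<open>Matrix.vec n\<close> turns its elements into vectors for matrix multiplication.
\<close>

definition mat_exp :: "real mat \<Rightarrow> real mat" where
  "mat_exp M = mat (dim_row M) (dim_row M) (\<lambda>(i, j). \<Sum>k. (M ^\<^sub>m k) $$ (i, j) / fact k)"

definition linearizing :: "'a topology \<Rightarrow> (real \<Rightarrow> 'a \<Rightarrow> 'a) \<Rightarrow> nat \<Rightarrow> ('a \<Rightarrow> nat \<Rightarrow> real) \<Rightarrow> bool" where
  "linearizing X \<Phi> n F \<longleftrightarrow>
     F \<in> topspace X \<rightarrow> topspace (Euclidean_space n) \<and>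
     (\<exists>B \<in> carrier_mat n n. \<forall>t. \<forall>x\<in>topspace X.
        Matrix.vec n (F (\<Phi> t x)) = mat_exp (t \<cdot>\<^sub>m B) *\<^sub>v Matrix.vec n (F x))"

text \<open>The differential at \<open>x\<close> is expressed in the chart \<open>(U, \<phi>)\<close> on the source.\<close>

definition chart_differential :: "nat \<Rightarrow> ('a \<Rightarrow> nat \<Rightarrow> real) \<Rightarrow>
    ('a, 'e::real_normed_vector) chart \<Rightarrow> 'a \<Rightarrow> 'e \<Rightarrow> nat \<Rightarrow> real" where
  "chart_differential n F = (\<lambda>(U, \<phi>) x v. restrict
     (\<lambda>i. frechet_derivative (\<lambda>p. F (inv_into U \<phi> p) i) (at (\<phi> x)) v) {..<n})"

definition immersion :: "('a, 'e::real_normed_vector) chart set \<Rightarrow>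
    nat \<Rightarrow> ('a \<Rightarrow> nat \<Rightarrow> real) \<Rightarrow> bool" where
  "immersion A n F \<longleftrightarrow> (\<forall>(U, \<phi>)\<in>A. \<forall>x\<in>U. inj (chart_differential n F (U, \<phi>) x))"

text \<open>A map into \<open>\<real>\<^sup>n\<close> is \<open>C\<^sup>1\<close> iff its components are.\<close>

definition C1_embedding :: "'a topology \<Rightarrow> ('a, 'e::real_normed_vector) chart set \<Rightarrow>
    nat \<Rightarrow> ('a \<Rightarrow> nat \<Rightarrow> real) \<Rightarrow> bool" where
  "C1_embedding X A n F \<longleftrightarrow>
     (\<forall>i<n. C1_map X A euclideanreal real_atlas (\<lambda>x. F x i)) \<and>
     immersion A n F \<and>
     embedding_map X (Euclidean_space n) F"

definition linearizable_by_C1_embedding :: "'a topology \<Rightarrow>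
    ('a, 'e::real_normed_vector) chart set \<Rightarrow> (real \<Rightarrow> 'a \<Rightarrow> 'a) \<Rightarrow> bool" where
  "linearizable_by_C1_embedding X A \<Phi> \<longleftrightarrow>
     (\<exists>n F. linearizing X \<Phi> n F \<and> C1_embedding X A n F)"

end

theory Submission
  imports Defs
begin

text \<open>
  Let \<open>F\<close> be a linearizing \<open>C\<^sup>1\<close> embedding and \<open>x\<^sub>0\<close> an equilibrium. The derivatives
  \<open>A t\<close> of the time-\<open>t\<close> maps at \<open>x\<^sub>0\<close>, written in a chart, form a one-parameter group of linear
  maps of \<open>\<real>\<^sup>d\<close>. Since \<open>X\<close> is compact, \<open>F\<close> is bounded along the flow, so \<open>e\<^bsup>Bt\<^esup>\<close> is bounded on the
  span of \<open>F(X) - F(x\<^sub>0)\<close>; the differential of \<open>F\<close> embeds \<open>A\<close> into this bounded group, so \<open>A\<close> is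
  bounded, too. If \<open>d\<close> is odd, each \<open>A (t/2)\<close> has a real eigenvalue, which boundedness forces to
  be \<open>\<plusminus>1\<close>; hence each \<open>A t\<close> fixes a nonzero vector, and compactness of the unit sphere gives a
  nonzero \<open>v\<close> fixed by all \<open>A t\<close> (\<open>bounded_linear_group_odd_dimension_fixed_vector\<close>).

  It remains to turn \<open>v\<close> into equilibria arbitrarily close to \<open>x\<^sub>0\<close>. Boundedness is used again, to
  average: if \<open>L\<close> is a linear left inverse of the differential of \<open>F\<close> at \<open>x\<^sub>0\<close>, a limit of
  long-time means of \<open>A (-t) (L (F (\<Phi> t x) - F x\<^sub>0))\<close> is a map \<open>h\<close> of \<open>X\<close> into \<open>\<real>\<^sup>d\<close> with
  \<open>h (\<Phi> t x) = A t (h x)\<close>. It depends linearly on \<open>F x - F x\<^sub>0\<close>, so it is \<open>C\<^sup>1\<close>, and in the chart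
  its derivative at \<open>x\<^sub>0\<close> is the identity (\<open>local_linearization\<close>). By the inverse function theorem
  \<open>h\<close> is a homeomorphism near \<open>x\<^sub>0\<close>, so there are points \<open>z\<close> arbitrarily close to \<open>x\<^sub>0\<close> at which
  \<open>h z\<close> is a nonzero multiple of \<open>v\<close>. Along the orbit of \<open>z\<close> the value of \<open>h\<close> is constant, and the
  orbit never leaves the neighbourhood on which \<open>h\<close> is injective (\<open>orbits_stay_close\<close>). So \<open>z\<close> is
  an equilibrium, and \<open>x\<^sub>0\<close> is not isolated (\<open>fixed_vector_imp_not_isolated\<close>).
\<close>

section \<open>Linear dependence of finitely many functions\<close>

text \<open>
  The vectors \<open>D x\<close> span a subspace of \<open>\<real>\<^sup>n\<close>, which has a basis consisting of finitely many
  \<open>D j\<close>, and the coordinates in this basis extend to linear functionals \<open>\<gamma> j\<close> on \<open>\<real>\<^sup>n\<close>. Gaussian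
  elimination of one coordinate at a time keeps \<open>n\<close> a number instead of a type.
\<close>

lemma finite_spanning_family:
  fixes D :: "'a \<Rightarrow> nat \<Rightarrow> real"
  shows "\<exists>J \<gamma>. finite J \<and> J \<subseteq> S \<and>
    (\<forall>x\<in>S. \<forall>i<n. D x i = (\<Sum>j\<in>J. (\<Sum>l<n. \<gamma> j l * D x l) * D j i))"
proof (induction n arbitrary: D)
  case 0
  then show ?case by (intro exI[of _ "{}"]) auto
next
  case (Suc n)
  show ?case
  proof (cases "\<forall>x\<in>S. D x n = 0")
    case True
    obtain J \<gamma> where J: "finite J" "J \<subseteq> S"
      and dec: "\<forall>x\<in>S. \<forall>i<n. D x i = (\<Sum>j\<in>J. (\<Sum>l<n. \<gamma> j l * D x l) * D j i)"
      using Suc.IH[of D] by blast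
    have "D x i = (\<Sum>j\<in>J. (\<Sum>l<Suc n. \<gamma> j l * D x l) * D j i)" if "x \<in> S" "i < Suc n" for x i
    proof (cases "i = n")
      case True
      have "(\<Sum>j\<in>J. (\<Sum>l<Suc n. \<gamma> j l * D x l) * D j i) = 0"
        using \<open>\<forall>x\<in>S. D x n = 0\<close> True J by (intro sum.neutral) auto
      then show ?thesis using \<open>\<forall>x\<in>S. D x n = 0\<close> that True by simp
    next
      case False
      then show ?thesis using dec that \<open>\<forall>x\<in>S. D x n = 0\<close> by auto
    qed
    then show ?thesis using J by blast
  next
    case False
    then obtain z where z: "z \<in> S" "D z n \<noteq> 0" by blast
    define a where "a x = D x n / D z n" for x
    define E where "E x i = D x i - a x * D z i" for x i
    obtain J' \<gamma> where J': "finite J'" "J' \<subseteq> S"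
      and dec': "\<forall>x\<in>S. \<forall>i<n. E x i = (\<Sum>j\<in>J'. (\<Sum>l<n. \<gamma> j l * E x l) * E j i)"
      using Suc.IH[of E] by blast
    \<comment> \<open>\<open>z\<close> contributes nothing to sums over \<open>J'\<close> because \<open>E z\<close> vanishes; without it in \<open>J\<close>,
        it can be inserted as a new index.\<close>
    define J where "J = J' - {z}"
    have J: "finite J" "J \<subseteq> S" "z \<notin> J" using J' by (auto simp: J_def)
    have Ez: "E z i = 0" for i using z by (simp add: E_def a_def)
    have En: "E x n = 0" for x using z by (simp add: E_def a_def)
    define c where "c x j = (\<Sum>l<n. \<gamma> j l * E x l)" for x j
    have dec: "E x i = (\<Sum>j\<in>J. c x j * E j i)" if "x \<in> S" "i < Suc n" for x i
    proof (cases "i = n")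
      case True
      then show ?thesis by (simp add: En)
    next
      case False
      then have "E x i = (\<Sum>j\<in>J'. c x j * E j i)" using dec' that by (simp add: c_def)
      also have "\<dots> = (\<Sum>j\<in>J. c x j * E j i)"
        unfolding J_def by (rule sum.mono_neutral_right) (use J' Ez in auto)
      finally show ?thesis .
    qed
    \<comment> \<open>\<open>\<delta>\<close> and \<open>\<epsilon>\<close> express the new coefficients, at \<open>j\<close> and at \<open>z\<close>, by \<open>D x\<close> itself instead of \<open>E x\<close>.\<close>
    define \<delta> where "\<delta> j l = (if l < n then \<gamma> j l else - (\<Sum>m<n. \<gamma> j m * D z m) / D z n)" for j l
    have c: "c x j = (\<Sum>l<Suc n. \<delta> j l * D x l)" for x j
      by (simp add: c_def E_def \<delta>_def a_def right_diff_distrib sum_subtractf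
          sum_distrib_left sum_distrib_right mult.assoc mult.left_commute sum_divide_distrib sum_negf)
        (simp add: mult_ac sum_distrib_left)
    define \<epsilon> where "\<epsilon> l = (if l = n then 1 / D z n else 0) - (\<Sum>j\<in>J. a j * \<delta> j l)" for l
    have e: "(\<Sum>l<Suc n. \<epsilon> l * D x l) = a x - (\<Sum>j\<in>J. c x j * a j)" for x
    proof -
      have "(\<Sum>l<Suc n. (\<Sum>j\<in>J. a j * \<delta> j l) * D x l) = (\<Sum>j\<in>J. c x j * a j)"
        unfolding c sum_distrib_right by (subst sum.swap) (simp add: mult_ac)
      moreover have "(\<Sum>l<Suc n. (if l = n then 1 / D z n else 0) * D x l) = a x"
        by (simp add: a_def)
      ultimately show ?thesis
        unfolding \<epsilon>_def left_diff_distrib sum_subtractf by simp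
    qed
    have "D x i = (\<Sum>j\<in>insert z J. (\<Sum>l<Suc n. (\<delta>(z := \<epsilon>)) j l * D x l) * D j i)"
      if "x \<in> S" "i < Suc n" for x i
    proof -
      have "(\<Sum>j\<in>insert z J. (\<Sum>l<Suc n. (\<delta>(z := \<epsilon>)) j l * D x l) * D j i)
          = (\<Sum>l<Suc n. \<epsilon> l * D x l) * D z i + (\<Sum>j\<in>J. (\<Sum>l<Suc n. (\<delta>(z := \<epsilon>)) j l * D x l) * D j i)"
        using J by (subst sum.insert) auto
      also have "(\<Sum>j\<in>J. (\<Sum>l<Suc n. (\<delta>(z := \<epsilon>)) j l * D x l) * D j i) = (\<Sum>j\<in>J. c x j * D j i)"
        unfolding c using J by (intro sum.cong refl) (auto simp del: sum.lessThan_Suc)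
      also have "(\<Sum>l<Suc n. \<epsilon> l * D x l) * D z i + (\<Sum>j\<in>J. c x j * D j i)
          = a x * D z i + (\<Sum>j\<in>J. c x j * (D j i - a j * D z i))"
        unfolding e by (simp add: algebra_simps sum_subtractf sum_distrib_left)
      also have "\<dots> = D x i" using dec[OF that] by (simp add: E_def)
      finally show ?thesis ..
    qed
    moreover have "finite (insert z J)" "insert z J \<subseteq> S" using J z by auto
    ultimately show ?thesis by blast
  qed
qed

section \<open>Bounded one-parameter groups in odd dimension\<close>

text \<open>
  The characteristic polynomial \<open>q\<close> has odd degree, so it changes sign. Its sign far out is
  read off from \<open>P s = det (1 - s A)\<close>, which is close to \<open>1\<close> for small \<open>s\<close>.
\<close>

lemma odd_dimension_real_eigenvector:
  fixes f :: "real^'n \<Rightarrow> real^'n"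
  assumes "odd CARD('n)" "linear f"
  obtains x v where "v \<noteq> 0" "f v = x *\<^sub>R v"
proof -
  define A where "A = matrix f"
  define P where "P s = det (Finite_Cartesian_Product.mat 1 - s *\<^sub>R A)" for s
  define q where "q x = det (x *\<^sub>R Finite_Cartesian_Product.mat 1 - A)" for x
  have cont: "continuous_on UNIV P" "continuous_on UNIV q"
    unfolding P_def q_def det_def by (intro continuous_intros; simp)+
  have scale: "det (c *\<^sub>R M) = c ^ CARD('n) * det M" for c and M :: "real^'n^'n"
    using det_rows_mul[of "\<lambda>_. c" "\<lambda>i. M $ i"] by (simp add: scaleR_vec_def scalar_mult_eq_scaleR vec_eq_iff[symmetric])
  have "P 0 = 1" by (simp add: P_def)
  moreover have "isCont P 0" using cont(1) by (simp add: continuous_on_eq_continuous_at)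
  ultimately have "eventually (\<lambda>s. P s > 0) (at 0)"
    unfolding isCont_def by (auto dest!: order_tendstoD(1)[of _ _ _ 0])
  then obtain e where e: "e > 0" "\<And>s. s \<noteq> 0 \<Longrightarrow> \<bar>s\<bar> < e \<Longrightarrow> P s > 0"
    unfolding eventually_at by (auto simp: dist_real_def)
  define s where "s = e / 2"
  have s: "s > 0" "P s > 0" "P (- s) > 0" using e by (auto simp: s_def)
  have qP: "q (1 / t) = (1 / t) ^ CARD('n) * P t" if "t \<noteq> 0" for t
    unfolding P_def q_def scale[symmetric] using that by (simp add: algebra_simps)
  have "q (- (1 / s)) \<le> 0"
    using qP[of "- s"] s assms(1) by (simp add: mult_nonpos_nonneg)
  moreover have "q (1 / s) \<ge> 0"
    using qP[of s] s by simp
  moreover have "continuous_on {- (1 / s)..1 / s} q"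
    using cont(2) continuous_on_subset by blast
  ultimately obtain x where "q x = 0"
    using IVT'[of q "- (1/s)" 0 "1/s"] s by auto
  then have "\<not> inj ((*v) (x *\<^sub>R Finite_Cartesian_Product.mat 1 - A))"
    unfolding q_def using det_nz_iff_inj[of "(*v) (x *\<^sub>R Finite_Cartesian_Product.mat 1 - A)"] by simp
  then obtain v where v: "v \<noteq> 0" "(x *\<^sub>R Finite_Cartesian_Product.mat 1 - A) *v v = 0"
    by (metis (no_types) linear_injective_0 matrix_vector_mul_linear)
  have "A *v v = f v" using assms(2) by (simp add: A_def matrix_works)
  moreover have "(x *\<^sub>R Finite_Cartesian_Product.mat 1) *v v = x *\<^sub>R v"
    by (simp add: scaleR_matrix_vector_assoc[symmetric])
  ultimately have "f v = x *\<^sub>R v" using v by (simp add: matrix_vector_mult_diff_rdistrib)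
  then show ?thesis using that v by blast
qed

text \<open>
  An eigenvalue of modulus other than \<open>1\<close> would make the powers of \<open>A s\<close> or of \<open>A (-s)\<close> unbounded,
  so a real eigenvector of \<open>A (t/2)\<close> is fixed by \<open>A t\<close>. The sets of unit vectors fixed by
  \<open>A (1/2\<^sup>k)\<close> are compact and decrease with \<open>k\<close>, hence have a common element; it is fixed at all
  dyadic times and, by continuity, at all times.
\<close>

lemma bounded_linear_group_odd_dimension_fixed_vector:
  fixes A :: "real \<Rightarrow> real^'n \<Rightarrow> real^'n"
  assumes odd: "odd CARD('n)" and lin: "\<And>t. linear (A t)"
    and zero: "\<And>v. A 0 v = v" and add: "\<And>s t v. A (s + t) v = A s (A t v)"
    and bd: "\<And>t v. norm (A t v) \<le> C * norm v"
    and cont: "\<And>v. continuous_on UNIV (\<lambda>t. A t v)"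
  obtains v where "v \<noteq> 0" "\<And>t. A t v = v"
proof -
  have pow: "A (real k * s) v = x ^ k *\<^sub>R v" if "A s v = x *\<^sub>R v" for k s x v
  proof (induction k)
    case (Suc k)
    have "A (real (Suc k) * s) v = A s (A (real k * s) v)"
      by (simp add: add[symmetric] algebra_simps)
    also have "\<dots> = x ^ Suc k *\<^sub>R v"
      using Suc that linear_scale[OF lin[of s]] by simp
    finally show ?case .
  qed (simp add: zero)
  have le1: "\<bar>x\<bar> \<le> 1" if "A s v = x *\<^sub>R v" "v \<noteq> 0" for s x v
  proof (rule ccontr)
    assume "\<not> \<bar>x\<bar> \<le> 1"
    then obtain k where "C < \<bar>x\<bar> ^ k" using real_arch_pow[of "\<bar>x\<bar>" C] by auto
    moreover have "\<bar>x\<bar> ^ k * norm v \<le> C * norm v"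
      using bd[of "real k * s" v] pow[OF that(1), of k] by (simp add: power_abs)
    ultimately show False using that(2) by simp
  qed
  have fixed: "\<exists>v. norm v = 1 \<and> A t v = v" for t
  proof -
    obtain x v where v: "v \<noteq> 0" "A (t / 2) v = x *\<^sub>R v"
      using odd_dimension_real_eigenvector[OF odd lin] by blast
    have inv: "v = x *\<^sub>R A (- (t / 2)) v"
      using add[of "- (t / 2)" "t / 2" v] v linear_scale[OF lin[of "- (t / 2)"]] by (simp add: zero)
    then have "x \<noteq> 0" using v by auto
    then have "A (- (t / 2)) v = (1 / x) *\<^sub>R v" using inv by (metis divide_inverse_commute
          mult.right_neutral real_vector.scale_one real_vector.scale_scale right_inverse
          mult.commute)
    then have "\<bar>1 / x\<bar> \<le> 1" using le1 v by blast
    moreover have "\<bar>x\<bar> \<le> 1" using le1 v by blast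
    ultimately have "\<bar>x\<bar> = 1" using \<open>x \<noteq> 0\<close> by (simp add: divide_simps)
    then have "x ^ 2 = 1" by (metis power2_abs power_one)
    moreover have "A t v = x ^ 2 *\<^sub>R v" using pow[OF v(2), of 2] by simp
    ultimately have Av: "A t v = v" by simp
    have "A t (sgn v) = sgn v"
      using linear_scale[OF lin[of t]] Av by (simp add: sgn_div_norm)
    then show ?thesis using v by (intro exI[of _ "sgn v"]) (simp add: norm_sgn)
  qed
  define K where "K k = {v. norm v = 1 \<and> A (1 / 2 ^ k) v = v}" for k :: nat
  have contA: "continuous_on UNIV (A t)" for t
    using lin linear_continuous_on linear_conv_bounded_linear by blast
  have "compact (K k)" for k
  proof -
    have "K k = sphere 0 1 \<inter> {v. A (1 / 2 ^ k) v = v}" by (auto simp: K_def)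
    moreover have "closed {v. A (1 / 2 ^ k) v = v}"
      by (intro closed_Collect_eq contA continuous_on_id)
    ultimately show ?thesis by (simp add: compact_Int_closed)
  qed
  moreover have "K k \<noteq> {}" for k using fixed[of "1 / 2 ^ k"] by (auto simp: K_def)
  moreover have "K n \<subseteq> K m" if "m \<le> n" for m n
  proof (rule lift_Suc_antimono_le[OF _ that])
    fix k
    have "A (1 / 2 ^ k) v = v" if "A (1 / 2 ^ Suc k) v = v" for v
      using add[of "1 / 2 ^ Suc k" "1 / 2 ^ Suc k" v] that by simp
    then show "K (Suc k) \<subseteq> K k" by (auto simp: K_def)
  qed
  ultimately have "\<Inter>(range K) \<noteq> {}" by (intro compact_nest) auto
  then obtain v where v: "\<And>k. v \<in> K k" by auto
  have nat_mult: "A (real m * s) v = v" if "A s v = v" for m s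
    using pow[of s v 1 m] that by simp
  have neg: "A (- s) v = v" if "A s v = v" for s
    using add[of "- s" s v] that zero by simp
  have dyadic: "A (of_int m / 2 ^ k) v = v" for m :: int and k
  proof -
    have 1: "A (1 / 2 ^ k) v = v" using v[of k] by (simp add: K_def)
    show ?thesis
    proof (cases "m \<ge> 0")
      case True
      then show ?thesis using nat_mult[OF 1, of "nat m"] by simp
    next
      case False
      then show ?thesis using neg[OF nat_mult[OF 1, of "nat (- m)"]] by simp
    qed
  qed
  have "A t v = v" for t
  proof (rule LIMSEQ_unique)
    have "(\<lambda>k. of_int \<lfloor>t * 2 ^ k\<rfloor> / 2 ^ k) \<longlonglongrightarrow> t"
    proof (rule tendsto_sandwich)
      show "\<forall>\<^sub>F k in sequentially. t - 1 / 2 ^ k \<le> of_int \<lfloor>t * 2 ^ k\<rfloor> / 2 ^ k"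
      proof (intro always_eventually allI)
        fix k :: nat
        have "t * 2 ^ k - 1 \<le> of_int \<lfloor>t * 2 ^ k\<rfloor>" by linarith
        then have "(t * 2 ^ k - 1) / 2 ^ k \<le> of_int \<lfloor>t * 2 ^ k\<rfloor> / 2 ^ k"
          by (simp add: divide_right_mono)
        then show "t - 1 / 2 ^ k \<le> of_int \<lfloor>t * 2 ^ k\<rfloor> / 2 ^ k"
          by (simp add: diff_divide_distrib)
      qed
      show "\<forall>\<^sub>F k in sequentially. of_int \<lfloor>t * 2 ^ k\<rfloor> / 2 ^ k \<le> t"
        by (intro always_eventually allI) (simp add: field_simps)
      have "(\<lambda>k. t - (1 / 2) ^ k) \<longlonglongrightarrow> t - 0"
        by (intro tendsto_intros LIMSEQ_power_zero) auto
      then show "(\<lambda>k. t - 1 / 2 ^ k) \<longlonglongrightarrow> t" by (simp add: power_one_over)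
    qed auto
    moreover have "isCont (\<lambda>t. A t v) t"
      using cont by (simp add: continuous_on_eq_continuous_at)
    ultimately show "(\<lambda>k. A (of_int \<lfloor>t * 2 ^ k\<rfloor> / 2 ^ k) v) \<longlonglongrightarrow> A t v"
      by (rule isCont_tendsto_compose[rotated])
    show "(\<lambda>k. A (of_int \<lfloor>t * 2 ^ k\<rfloor> / 2 ^ k) v) \<longlonglongrightarrow> v" by (simp add: dyadic)
  qed
  moreover have "v \<noteq> 0" using v[of 0] by (auto simp: K_def)
  ultimately show ?thesis using that by blast
qed

section \<open>Averaging along a flow\<close>

lemma common_convergent_subsequence:
  fixes m :: "'j \<Rightarrow> nat \<Rightarrow> 'b::heine_borel"
  assumes "finite J" "\<And>j. j \<in> J \<Longrightarrow> bounded (range (m j))"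
  shows "\<exists>r w. strict_mono (r :: nat \<Rightarrow> nat) \<and> (\<forall>j\<in>J. (\<lambda>k. m j (r k)) \<longlonglongrightarrow> w j)"
  using assms
proof (induction J)
  case empty
  show ?case by (intro exI[of _ id]) (auto simp: strict_mono_def)
next
  case (insert i J)
  then obtain r w where r: "strict_mono r" "\<forall>j\<in>J. (\<lambda>k. m j (r k)) \<longlonglongrightarrow> w j" by auto
  have "bounded (range (\<lambda>k. m i (r k)))"
    using insert.prems[of i] by (auto intro: bounded_subset)
  then obtain l r' where r': "strict_mono r'" "((\<lambda>k. m i (r k)) \<circ> r') \<longlonglongrightarrow> l"
    using bounded_imp_convergent_subsequence by blast
  have "(\<lambda>k. m j ((r \<circ> r') k)) \<longlonglongrightarrow> (w(i := l)) j" if "j \<in> insert i J" for j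
  proof (cases "j = i")
    case True
    then show ?thesis using r' by (simp add: o_def)
  next
    case False
    then have "(\<lambda>k. m j (r k)) \<longlonglongrightarrow> w j" using that r by auto
    then show ?thesis
      using LIMSEQ_subseq_LIMSEQ[OF _ r'(1), of "\<lambda>k. m j (r k)" "w j"] False by (simp add: o_def)
  qed
  then show ?case using strict_mono_o[OF r(1) r'(1)] by blast
qed

definition mean :: "real \<Rightarrow> (real \<Rightarrow> 'b::euclidean_space) \<Rightarrow> 'b" where
  "mean T f = (1 / T) *\<^sub>R integral {0..T} f"

lemma integrable_continuous_UNIV:
  fixes f :: "real \<Rightarrow> 'b::euclidean_space"
  assumes "continuous_on UNIV f"
  shows "f integrable_on {a..b}"
  using assms by (meson continuous_on_subset integrable_continuous_interval subset_UNIV)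

lemma norm_integral_bound:
  fixes f :: "real \<Rightarrow> 'b::euclidean_space"
  assumes "continuous_on UNIV f" "\<And>t. norm (f t) \<le> C" "a \<le> b"
  shows "norm (integral {a..b} f) \<le> C * (b - a)"
  using integral_bound[of a b f C] assms continuous_on_subset by blast

lemma norm_mean_le:
  assumes "continuous_on UNIV f" "\<And>t. norm (f t) \<le> C" "T > 0"
  shows "norm (mean T f) \<le> C"
  using norm_integral_bound[OF assms(1,2), of 0 T] assms(3)
  by (simp add: mean_def divide_simps)

text \<open>
  The integrals over \<open>[0, T]\<close> and \<open>[s, T + s]\<close> differ only on two intervals of length \<open>\<bar>s\<bar>\<close>, so long-time
  means are invariant under time shifts in the limit.
\<close>

lemma mean_shift_le:
  fixes f :: "real \<Rightarrow> 'b::euclidean_space"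
  assumes "continuous_on UNIV f" "\<And>t. norm (f t) \<le> C" "T > 0"
  shows "norm (mean T (\<lambda>t. f (t + s)) - mean T f) \<le> 2 * \<bar>s\<bar> * C / T"
proof -
  have pos: "norm (mean T (\<lambda>t. g (t + r)) - mean T g) \<le> 2 * r * C / T"
    if g: "continuous_on UNIV g" "\<And>t. norm (g t) \<le> C" and r: "r \<ge> 0"
    for g :: "real \<Rightarrow> 'b" and r
  proof -
    have "integral {0..T} (\<lambda>t. g (t + r)) = integral {r..T + r} g"
      using integral_shift_Icc_real[of 0 T g r] by (simp add: o_def add.commute)
    moreover have "integral {0..r} g + integral {r..T + r} g = integral {0..T} g + integral {T..T + r} g"
      using r assms(3) integrable_continuous_UNIV[OF g(1)]
      by (subst (1 2) Henstock_Kurzweil_Integration.integral_combine) auto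
    ultimately have "integral {0..T} (\<lambda>t. g (t + r)) - integral {0..T} g
        = integral {T..T + r} g - integral {0..r} g" by (simp add: algebra_simps)
    also have "norm \<dots> \<le> C * r + C * r"
      using norm_integral_bound[OF g, of T "T + r"] norm_integral_bound[OF g, of 0 r] r
      by (intro norm_triangle_le_diff) auto
    finally have "norm (integral {0..T} (\<lambda>t. g (t + r)) - integral {0..T} g) \<le> 2 * r * C" by (simp add: mult_ac)
    then show ?thesis using assms(3)
      by (simp add: mean_def scaleR_diff_right[symmetric] divide_right_mono mult.assoc mult.left_commute)
  qed
  show ?thesis
  proof (cases "s \<ge> 0")
    case True
    then show ?thesis using pos[OF assms(1,2), of s] by simp
  next
    case False
    have "continuous_on UNIV (\<lambda>t. f (t + s))"
      by (intro continuous_on_compose2[OF assms(1)] continuous_intros) auto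
    from pos[OF this, of "- s"] assms(2) False show ?thesis by (simp add: norm_minus_commute)
  qed
qed

lemma mean_const: "T > 0 \<Longrightarrow> mean T (\<lambda>_. v) = v"
  by (simp add: mean_def)

lemma mean_linear:
  assumes "bounded_linear A" "continuous_on UNIV f"
  shows "mean T (\<lambda>t. A (f t)) = A (mean T f)"
  using integral_linear[OF integrable_continuous_UNIV[OF assms(2)] assms(1), of 0 T]
  by (simp add: mean_def o_def linear_cmul[OF bounded_linear.linear[OF assms(1)]])

lemma mean_sum_scaleR:
  assumes "finite J" "\<And>j. j \<in> J \<Longrightarrow> continuous_on UNIV (f j)"
  shows "mean T (\<lambda>t. \<Sum>j\<in>J. c j *\<^sub>R f j t) = (\<Sum>j\<in>J. c j *\<^sub>R mean T (f j))"
proof -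
  have "integral {0..T} (\<lambda>t. \<Sum>j\<in>J. c j *\<^sub>R f j t) = (\<Sum>j\<in>J. c j *\<^sub>R integral {0..T} (f j))"
    using assms by (subst integral_sum) (auto intro!: integrable_continuous_UNIV continuous_intros)
  then show ?thesis by (simp add: mean_def scaleR_sum_right mult.commute)
qed

text \<open>
  The limit of the means of \<open>A (-t) (\<xi> (\<Phi> t x))\<close> is an equivariant version of \<open>\<xi>\<close>. The expansion of
  \<open>\<xi>\<close> along orbits by finitely many orbits \<open>\<Phi> t j\<close> serves two purposes: one subsequence of times makes
  the means converge at every \<open>x\<close>, and the limit \<open>\<Sum>j. c x j w j\<close> is as smooth in \<open>x\<close> as the
  coefficients. The second conclusion says that combinations of orbits which already are orbits of
  \<open>A\<close> are not changed by averaging; it determines the derivative of the limit.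
\<close>

lemma equivariant_average:
  fixes A :: "real \<Rightarrow> 'b::euclidean_space \<Rightarrow> 'b" and \<xi> :: "'a \<Rightarrow> 'b"
  assumes flow: "flow_on S \<Phi>"
    and lin: "\<And>t. linear (A t)" and zero: "\<And>v. A 0 v = v"
    and add: "\<And>s t v. A (s + t) v = A s (A t v)"
    and bd: "\<And>t v. norm (A t v) \<le> C * norm v"
    and cont: "\<And>v. continuous_on UNIV (\<lambda>t. A t v)"
    and J: "finite J" "J \<subseteq> S"
    and \<xi>_cont: "\<And>x. x \<in> S \<Longrightarrow> continuous_on UNIV (\<lambda>t. \<xi> (\<Phi> t x))"
    and \<xi>_bd: "\<And>x. x \<in> S \<Longrightarrow> norm (\<xi> x) \<le> K"
    and dec: "\<And>t x. x \<in> S \<Longrightarrow> \<xi> (\<Phi> t x) = (\<Sum>j\<in>J. c x j *\<^sub>R \<xi> (\<Phi> t j))"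
  obtains w where
    "\<And>s x. x \<in> S \<Longrightarrow> (\<Sum>j\<in>J. c (\<Phi> s x) j *\<^sub>R w j) = A s (\<Sum>j\<in>J. c x j *\<^sub>R w j)"
    and "\<And>a v. (\<And>t. (\<Sum>j\<in>J. a j *\<^sub>R \<xi> (\<Phi> t j)) = A t v) \<Longrightarrow> (\<Sum>j\<in>J. a j *\<^sub>R w j) = v"
proof -
  have in_S: "\<Phi> t x \<in> S" if "x \<in> S" for t x using flow that by (auto simp: flow_on_def)
  have flow_add: "\<Phi> (s + t) x = \<Phi> s (\<Phi> t x)" if "x \<in> S" for s t x
    using flow that by (auto simp: flow_on_def)
  have C: "C \<ge> 0"
  proof -
    obtain b :: 'b where "b \<in> Basis" using nonempty_Basis by blast
    then show ?thesis using bd[of 0 b] by (simp add: zero)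
  qed
  have blin: "bounded_linear (A t)" for t using lin linear_conv_bounded_linear by blast
  have A_basis: "A t v = (\<Sum>b\<in>Basis. (v \<bullet> b) *\<^sub>R A t b)" for t v
    by (metis (no_types, lifting) euclidean_representation linear_cmul lin linear_sum sum.cong)
  define f where "f x t = A (- t) (\<xi> (\<Phi> t x))" for x t
  have f_cont: "continuous_on UNIV (f x)" if "x \<in> S" for x
    unfolding f_def
    by (subst A_basis)
      (intro continuous_intros \<xi>_cont that continuous_on_compose2[OF cont]; simp)
  have f_bd: "norm (f x t) \<le> C * K" if "x \<in> S" for x t
    unfolding f_def using bd \<xi>_bd[OF in_S[OF that]] C by (meson mult_left_mono order_trans)
  define m where "m x k = mean (real (Suc k)) (f x)" for x k
  have "bounded (range (m x))" if "x \<in> S" for x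
    unfolding m_def bounded_iff
    by (intro exI[of _ "C * K"]) (auto intro!: norm_mean_le f_cont f_bd that)
  then obtain r w where r: "strict_mono (r :: nat \<Rightarrow> nat)"
    and w: "\<And>j. j \<in> J \<Longrightarrow> (\<lambda>k. m j (r k)) \<longlonglongrightarrow> w j"
    using common_convergent_subsequence[OF J(1), of m] J(2) by blast
  have f_dec: "f x t = (\<Sum>j\<in>J. c x j *\<^sub>R f j t)" if "x \<in> S" for x t
    unfolding f_def dec[OF that] by (simp add: linear_sum[OF lin] linear_cmul[OF lin])
  have lim_sum: "(\<lambda>k. mean (real (Suc (r k))) (\<lambda>t. \<Sum>j\<in>J. a j *\<^sub>R f j t)) \<longlonglongrightarrow> (\<Sum>j\<in>J. a j *\<^sub>R w j)" for a
    using J w f_cont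
    by (subst mean_sum_scaleR) (auto simp: m_def intro!: tendsto_intros)
  have lim: "(\<lambda>k. m x (r k)) \<longlonglongrightarrow> (\<Sum>j\<in>J. c x j *\<^sub>R w j)" if "x \<in> S" for x
  proof -
    have "f x = (\<lambda>t. \<Sum>j\<in>J. c x j *\<^sub>R f j t)" using f_dec[OF that] by blast
    then show ?thesis using lim_sum[of "c x"] by (simp add: m_def)
  qed
  show ?thesis
  proof
    fix s x assume x: "x \<in> S"
    have "f (\<Phi> s x) t = A s (f x (t + s))" for t
      by (simp add: f_def flow_add[OF x, symmetric] add[symmetric])
    then have "m (\<Phi> s x) k = A s (mean (real (Suc k)) (\<lambda>t. f x (t + s)))" for k
    proof -
      assume "\<And>t. f (\<Phi> s x) t = A s (f x (t + s))"
      then have "f (\<Phi> s x) = (\<lambda>t. A s (f x (t + s)))" by blast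
      moreover have "continuous_on UNIV (\<lambda>t. f x (t + s))"
        by (intro continuous_on_compose2[OF f_cont[OF x]] continuous_intros) auto
      ultimately show ?thesis unfolding m_def by (simp only: mean_linear[OF blin])
    qed
    moreover have "(\<lambda>k. mean (real (Suc (r k))) (\<lambda>t. f x (t + s))) \<longlonglongrightarrow> (\<Sum>j\<in>J. c x j *\<^sub>R w j)"
    proof -
      have "(\<lambda>k. mean (real (Suc k)) (\<lambda>t. f x (t + s)) - m x k) \<longlonglongrightarrow> 0"
      proof (rule Lim_null_comparison)
        show "\<forall>\<^sub>F k in sequentially. norm (mean (real (Suc k)) (\<lambda>t. f x (t + s)) - m x k)
            \<le> 2 * \<bar>s\<bar> * (C * K) / real (Suc k)"
          unfolding m_def using mean_shift_le[OF f_cont[OF x] f_bd[OF x]] by auto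
        show "(\<lambda>k. 2 * \<bar>s\<bar> * (C * K) / real (Suc k)) \<longlonglongrightarrow> 0"
          using LIMSEQ_Suc[OF lim_const_over_n[of "2 * \<bar>s\<bar> * (C * K)"]] by simp
      qed
      from tendsto_add[OF LIMSEQ_subseq_LIMSEQ[OF this r] lim[OF x]]
      show ?thesis by (simp add: o_def)
    qed
    ultimately have "(\<lambda>k. m (\<Phi> s x) (r k)) \<longlonglongrightarrow> A s (\<Sum>j\<in>J. c x j *\<^sub>R w j)"
      using bounded_linear.tendsto[OF blin] by simp
    then show "(\<Sum>j\<in>J. c (\<Phi> s x) j *\<^sub>R w j) = A s (\<Sum>j\<in>J. c x j *\<^sub>R w j)"
      using lim[OF in_S[OF x]] LIMSEQ_unique by blast
  next
    fix a v assume av: "\<And>t. (\<Sum>j\<in>J. a j *\<^sub>R \<xi> (\<Phi> t j)) = A t v"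
    have "(\<Sum>j\<in>J. a j *\<^sub>R f j t) = v" for t
    proof -
      have "(\<Sum>j\<in>J. a j *\<^sub>R f j t) = A (- t) (\<Sum>j\<in>J. a j *\<^sub>R \<xi> (\<Phi> t j))"
        unfolding f_def by (simp add: linear_sum[OF lin] linear_cmul[OF lin])
      also have "\<dots> = v" using add[of "- t" t v] by (simp add: av zero)
      finally show ?thesis .
    qed
    then show "(\<Sum>j\<in>J. a j *\<^sub>R w j) = v"
      using lim_sum[of a] by (simp add: mean_const LIMSEQ_const_iff)
  qed
qed

section \<open>Auxiliary facts on derivatives\<close>

text \<open>
  The \<open>l i\<close> are the components of an injective linear map into \<open>\<real>\<^sup>n\<close>. If \<open>g i\<close> represents \<open>l i\<close>,
  then \<open>N\<close> below is the Gram operator, which is positive definite, and \<open>e i = N\<^sup>-\<^sup>1 (g i)\<close>.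
\<close>

lemma jointly_injective_left_inverse:
  fixes l :: "nat \<Rightarrow> 'e::euclidean_space \<Rightarrow> real"
  assumes lin: "\<And>i. i < n \<Longrightarrow> linear (l i)" and inj: "\<And>v. (\<And>i. i < n \<Longrightarrow> l i v = 0) \<Longrightarrow> v = 0"
  obtains e where "\<And>v. (\<Sum>i<n. l i v *\<^sub>R e i) = v"
proof -
  define g where "g i = (\<Sum>b\<in>Basis. l i b *\<^sub>R b)" for i
  have lg: "l i v = g i \<bullet> v" if "i < n" for i v
  proof -
    have "l i v = l i (\<Sum>b\<in>Basis. (v \<bullet> b) *\<^sub>R b)" by (simp add: euclidean_representation)
    also have "\<dots> = (\<Sum>b\<in>Basis. (v \<bullet> b) * l i b)"
      by (simp add: linear_sum[OF lin[OF that]] linear_cmul[OF lin[OF that]])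
    finally show ?thesis by (simp add: g_def inner_sum_right inner_commute mult.commute)
  qed
  define N where "N v = (\<Sum>i<n. l i v *\<^sub>R g i)" for v
  have "linear N" unfolding N_def
    by (intro linear_compose_sum ballI linearI)
       (auto simp: lg inner_add_right scaleR_add_left)
  have "v = 0" if "N v = 0" for v
  proof (rule inj)
    have "(\<Sum>i<n. (l i v)\<^sup>2) = N v \<bullet> v"
      by (simp add: N_def inner_sum_left lg power2_eq_square)
    then have "(\<Sum>i<n. (l i v)\<^sup>2) = 0" using that by simp
    then show "l i v = 0" if "i < n" for i
      using that by (subst (asm) sum_nonneg_eq_0_iff) auto
  qed
  then have "inj N" using linear_injective_0[OF \<open>linear N\<close>] by blast
  then obtain T where T: "linear T" "T \<circ> N = id"
    using linear_injective_left_inverse[OF \<open>linear N\<close>] by blast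
  have "(\<Sum>i<n. l i v *\<^sub>R T (g i)) = v" for v
  proof -
    have "(\<Sum>i<n. l i v *\<^sub>R T (g i)) = T (N v)"
      by (simp add: N_def linear_sum[OF T(1)] linear_cmul[OF T(1)])
    then show ?thesis using T(2) by (metis comp_apply id_apply)
  qed
  then show ?thesis by (rule that)
qed

lemma C1_on_imp_has_derivative: "C1_on S f \<Longrightarrow> p \<in> S \<Longrightarrow> \<exists>f'. (f has_derivative f') (at p)"
  unfolding C1_on_def by blast

lemma C1_map_chartD:
  assumes "C1_map Y B Z C f" "(V, \<alpha>) \<in> B" "(W, \<beta>) \<in> C"
  shows "C1_on (\<alpha> ` {x \<in> V. f x \<in> W}) (\<beta> \<circ> f \<circ> inv_into V \<alpha>)"
proof -
  have "\<forall>(V, \<alpha>)\<in>B. \<forall>(W, \<beta>)\<in>C. C1_on (\<alpha> ` {x \<in> V. f x \<in> W}) (\<beta> \<circ> f \<circ> inv_into V \<alpha>)"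
    using assms(1) by (simp add: C1_map_def)
  from bspec[OF this assms(2)] have "\<forall>(W, \<beta>)\<in>C. C1_on (\<alpha> ` {x \<in> V. f x \<in> W}) (\<beta> \<circ> f \<circ> inv_into V \<alpha>)"
    by simp
  from bspec[OF this assms(3)] show ?thesis by simp
qed

lemma has_derivative_unique_eventually:
  assumes "(f has_derivative f') (at p)" "(g has_derivative g') (at p)"
    and "\<forall>\<^sub>F q in nhds p. f q = g q"
  shows "f' = g'"
proof -
  obtain V where V: "open V" "p \<in> V" "\<And>q. q \<in> V \<Longrightarrow> f q = g q"
    using assms(3) unfolding eventually_nhds by blast
  have "(g has_derivative f') (at p)"
    using has_derivative_transform_within_open[OF assms(1) V(1,2)] V(3) by blast
  then show ?thesis using assms(2) has_derivative_unique by blast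
qed

section \<open>An equilibrium of a linearized flow\<close>

locale linearized_equilibrium =
  fixes X :: "'a topology" and A :: "('a, 'e::euclidean_space) chart set"
    and \<Phi> :: "real \<Rightarrow> 'a \<Rightarrow> 'a" and n :: nat and F :: "'a \<Rightarrow> nat \<Rightarrow> real"
    and x\<^sub>0 :: 'a and U :: "'a set" and \<phi> :: "'a \<Rightarrow> 'e"
  assumes atlas: "C1_atlas X A"
    and compact: "compact_space X"
    and flow: "C1_flow X A \<Phi>"
    and linearizing: "linearizing X \<Phi> n F"
    and embedding: "C1_embedding X A n F"
    and equilibrium: "x\<^sub>0 \<in> equilibria X \<Phi>"
    and chart: "(U, \<phi>) \<in> A" and in_chart: "x\<^sub>0 \<in> U"
begin

abbreviation "\<psi> \<equiv> inv_into U \<phi>"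
abbreviation "p\<^sub>0 \<equiv> \<phi> x\<^sub>0"

text \<open>
  The displacement \<open>F x - F x\<^sub>0\<close> from the equilibrium, on which \<open>e\<^bsup>Bt\<^esup>\<close> acts linearly
  because it fixes \<open>F x\<^sub>0\<close>.
\<close>

definition disp :: "'a \<Rightarrow> nat \<Rightarrow> real" where "disp x i = F x i - F x\<^sub>0 i"

lemma is_chart: "is_chart X (U, \<phi>)"
  using atlas chart by (auto simp: C1_atlas_def)

lemma open_U: "openin X U" and open_image: "open (\<phi> ` U)"
  and hom: "homeomorphic_map (subtopology X U) (top_of_set (\<phi> ` U)) \<phi>"
  using is_chart by (auto simp: is_chart_def)

lemma U_subset: "U \<subseteq> topspace X"
  using open_U openin_subset by blast

lemma inj_\<phi>: "inj_on \<phi> U"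
  using homeomorphic_imp_injective_map[OF hom] U_subset by (simp add: Int_absorb1)

lemma \<psi>_\<phi>: "x \<in> U \<Longrightarrow> \<psi> (\<phi> x) = x"
  using inj_\<phi> by simp

lemma \<phi>_\<psi>: "p \<in> \<phi> ` U \<Longrightarrow> \<phi> (\<psi> p) = p"
  by (rule f_inv_into_f)

lemma \<psi>_in: "p \<in> \<phi> ` U \<Longrightarrow> \<psi> p \<in> U"
  by (rule inv_into_into)

lemma \<psi>_in_X: "p \<in> \<phi> ` U \<Longrightarrow> \<psi> p \<in> topspace X"
  using \<psi>_in U_subset by blast

lemma p0_in: "p\<^sub>0 \<in> \<phi> ` U" using in_chart by simp

lemma continuous_\<psi>: "continuous_map (top_of_set (\<phi> ` U)) X \<psi>"
proof -
  obtain g where g: "homeomorphic_maps (subtopology X U) (top_of_set (\<phi> ` U)) \<phi> g"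
    using hom homeomorphic_map_maps by blast
  have "continuous_map (top_of_set (\<phi> ` U)) X g"
    using g by (auto simp: homeomorphic_maps_def continuous_map_in_subtopology)
  moreover have "g p = \<psi> p" if "p \<in> \<phi> ` U" for p
    using g that U_subset \<psi>_\<phi> by (auto simp: homeomorphic_maps_def)
  ultimately show ?thesis by (auto elim: continuous_map_eq)
qed

lemma open_preimage_\<psi>: "openin X V \<Longrightarrow> open {p \<in> \<phi> ` U. \<psi> p \<in> V}"
  using openin_continuous_map_preimage[OF continuous_\<psi>, of V] open_image
  by (auto simp: openin_open_eq)

lemma open_image_\<psi>:
  assumes "open V" "V \<subseteq> \<phi> ` U" shows "openin X (\<psi> ` V)"
proof -
  have "continuous_map (subtopology X U) euclidean \<phi>"
    using hom homeomorphic_imp_continuous_map continuous_map_in_subtopology by blast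
  from openin_continuous_map_preimage[OF this, of V] assms(1) U_subset
  have "openin (subtopology X U) {x \<in> U. \<phi> x \<in> V}" by (simp add: Int_absorb1)
  moreover have "{x \<in> U. \<phi> x \<in> V} = \<psi> ` V"
    using assms(2) \<phi>_\<psi> \<psi>_in \<psi>_\<phi> by (auto simp: image_iff subset_iff) metis
  ultimately show ?thesis using open_U openin_trans_full by fastforce
qed

lemma flow_on: "flow_on (topspace X) \<Phi>"
  using flow by (simp add: C1_flow_def)

lemma \<Phi>_in: "x \<in> topspace X \<Longrightarrow> \<Phi> t x \<in> topspace X"
  and \<Phi>_0: "x \<in> topspace X \<Longrightarrow> \<Phi> 0 x = x"
  and \<Phi>_add: "x \<in> topspace X \<Longrightarrow> \<Phi> (s + t) x = \<Phi> s (\<Phi> t x)"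
  using flow_on by (auto simp: flow_on_def)

lemma \<Phi>_x0: "\<Phi> t x\<^sub>0 = x\<^sub>0" and x0_in: "x\<^sub>0 \<in> topspace X"
  using equilibrium by (auto simp: equilibria_def)

lemma continuous_flow: "continuous_map (prod_topology euclideanreal X) X (\<lambda>(t, x). \<Phi> t x)"
  using flow by (simp add: C1_flow_def C1_map_def)

lemma continuous_\<Phi>: "continuous_map X X (\<Phi> t)"
  using continuous_map_compose[OF continuous_map_pairedI[of X euclideanreal "\<lambda>_. t" X "\<lambda>x. x"] continuous_flow]
  by (simp add: o_def)

lemma continuous_orbit: "x \<in> topspace X \<Longrightarrow> continuous_map euclideanreal X (\<lambda>t. \<Phi> t x)"
  using continuous_map_compose[OF continuous_map_pairedI[of euclideanreal euclideanreal "\<lambda>t. t" X "\<lambda>_. x"] continuous_flow]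
  by (simp add: o_def)

lemma continuous_disp: "i < n \<Longrightarrow> continuous_map X euclideanreal (\<lambda>x. disp x i)"
  using embedding unfolding disp_def C1_embedding_def C1_map_def
  by (intro continuous_map_diff) auto

lemma disp_x0: "disp x\<^sub>0 i = 0" by (simp add: disp_def)

lemma disp_injective:
  assumes "x \<in> topspace X" "\<And>i. i < n \<Longrightarrow> disp x i = 0" shows "x = x\<^sub>0"
proof -
  have "embedding_map X (Euclidean_space n) F" using embedding by (simp add: C1_embedding_def)
  then have inj: "inj_on F (topspace X)"
    unfolding embedding_map_def using homeomorphic_imp_injective_map by blast
  have "F y i = 0" if "y \<in> topspace X" "\<not> i < n" for y i
    using linearizing that by (auto simp: linearizing_def topspace_Euclidean_space Pi_iff)
  then have "F x i = F x\<^sub>0 i" for i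
    using assms x0_in by (cases "i < n") (auto simp: disp_def)
  then have "F x = F x\<^sub>0" by blast
  then show ?thesis using inj assms(1) x0_in by (auto dest: inj_onD)
qed

lemma disp_bounded: obtains M where "\<And>x i. x \<in> topspace X \<Longrightarrow> i < n \<Longrightarrow> \<bar>disp x i\<bar> \<le> M" "M \<ge> 0"
proof -
  have "\<exists>M. \<forall>x\<in>topspace X. \<bar>disp x i\<bar> \<le> M" if "i < n" for i
  proof -
    have "compactin euclideanreal ((\<lambda>x. disp x i) ` topspace X)"
      using image_compactin[OF _ continuous_disp[OF that], of "topspace X"] compact
      by (simp add: compact_space_def)
    then have "bounded ((\<lambda>x. disp x i) ` topspace X)" by (simp add: compact_imp_bounded)
    then show ?thesis by (auto simp: bounded_iff)
  qed
  then obtain M where M: "\<And>x i. x \<in> topspace X \<Longrightarrow> i < n \<Longrightarrow> \<bar>disp x i\<bar> \<le> M i" by metis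
  have "\<bar>disp x i\<bar> \<le> (\<Sum>i<n. \<bar>M i\<bar>)" if "x \<in> topspace X" "i < n" for x i
  proof -
    have "\<bar>disp x i\<bar> \<le> \<bar>M i\<bar>" using M[OF that] by linarith
    also have "\<dots> \<le> (\<Sum>i<n. \<bar>M i\<bar>)" using that by (intro member_le_sum) auto
    finally show ?thesis .
  qed
  then show ?thesis using that by (meson abs_ge_zero sum_nonneg)
qed

lemma disp_\<Phi>_linear:
  obtains E where "\<And>x i. x \<in> topspace X \<Longrightarrow> i < n \<Longrightarrow> disp (\<Phi> t x) i = (\<Sum>l<n. E i l * disp x l)"
proof -
  obtain B where B: "B \<in> carrier_mat n n" "\<forall>t. \<forall>x\<in>topspace X.
        Matrix.vec n (F (\<Phi> t x)) = mat_exp (t \<cdot>\<^sub>m B) *\<^sub>v Matrix.vec n (F x)"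
    using linearizing by (auto simp: linearizing_def)
  define E where "E i l = mat_exp (t \<cdot>\<^sub>m B) $$ (i, l)" for i l
  have E: "F (\<Phi> t x) i = (\<Sum>l<n. E i l * F x l)" if "x \<in> topspace X" "i < n" for x i
  proof -
    have "F (\<Phi> t x) i = vec_index (Matrix.vec n (F (\<Phi> t x))) i" using that by simp
    also have "\<dots> = vec_index (mat_exp (t \<cdot>\<^sub>m B) *\<^sub>v Matrix.vec n (F x)) i" using B that by simp
    also have "\<dots> = (\<Sum>l<n. E i l * F x l)"
      using B(1) that by (simp add: mat_exp_def E_def scalar_prod_def row_def lessThan_atLeast0)
    finally show ?thesis .
  qed
  have "disp (\<Phi> t x) i = (\<Sum>l<n. E i l * disp x l)" if "x \<in> topspace X" "i < n" for x i
    using E[OF that] E[OF x0_in that(2)] \<Phi>_x0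
    by (simp add: disp_def right_diff_distrib sum_subtractf)
  then show ?thesis by (rule that)
qed

text \<open>
  The coefficients do not depend on \<open>t\<close>, since \<open>e\<^bsup>Bt\<^esup>\<close> carries an expansion at time \<open>0\<close> to one at
  time \<open>t\<close>. With compactness of \<open>X\<close> this bounds the flow uniformly in time, although nothing is known about
  \<open>e\<^bsup>Bt\<^esup>\<close> off the span of the displacements.
\<close>

lemma disp_\<Phi>_spanning:
  obtains J \<gamma> where "finite J" "J \<subseteq> topspace X"
    "\<And>t x i. x \<in> topspace X \<Longrightarrow> i < n \<Longrightarrow>
      disp (\<Phi> t x) i = (\<Sum>j\<in>J. (\<Sum>l<n. \<gamma> j l * disp x l) * disp (\<Phi> t j) i)"
proof -
  obtain J \<gamma> where J: "finite J" "J \<subseteq> topspace X"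
    and dec: "\<And>x i. x \<in> topspace X \<Longrightarrow> i < n \<Longrightarrow> disp x i = (\<Sum>j\<in>J. (\<Sum>l<n. \<gamma> j l * disp x l) * disp j i)"
    using finite_spanning_family[of "topspace X" n disp] by blast
  have "disp (\<Phi> t x) i = (\<Sum>j\<in>J. (\<Sum>l<n. \<gamma> j l * disp x l) * disp (\<Phi> t j) i)"
    if x: "x \<in> topspace X" "i < n" for t x i
  proof -
    obtain E where E: "\<And>x i. x \<in> topspace X \<Longrightarrow> i < n \<Longrightarrow> disp (\<Phi> t x) i = (\<Sum>k<n. E i k * disp x k)"
      using disp_\<Phi>_linear by blast
    define c where "c j = (\<Sum>l<n. \<gamma> j l * disp x l)" for j
    have "disp (\<Phi> t x) i = (\<Sum>k<n. E i k * (\<Sum>j\<in>J. c j * disp j k))"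
      using E[OF x] dec[OF x(1)] by (simp add: c_def)
    also have "\<dots> = (\<Sum>j\<in>J. c j * (\<Sum>k<n. E i k * disp j k))"
      unfolding sum_distrib_left by (subst sum.swap) (simp add: mult_ac)
    also have "\<dots> = (\<Sum>j\<in>J. c j * disp (\<Phi> t j) i)"
      using E J(2) x(2) by (intro sum.cong) auto
    finally show ?thesis by (simp add: c_def)
  qed
  then show ?thesis using J that by blast
qed

text \<open>
  Lyapunov stability of \<open>x\<^sub>0\<close> in both time directions. The displacement of the whole orbit of \<open>x\<close> is
  at most \<open>b x\<close>, which is small near \<open>x\<^sub>0\<close>; outside \<open>V\<close> the displacement is bounded away from \<open>0\<close>, by
  compactness and injectivity of \<open>F\<close>.
\<close>

lemma orbits_stay_close:
  assumes "openin X V" "x\<^sub>0 \<in> V"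
  obtains N where "openin X N" "x\<^sub>0 \<in> N" "\<And>x t. x \<in> N \<Longrightarrow> \<Phi> t x \<in> V"
proof -
  obtain J \<gamma> where J: "finite J" "J \<subseteq> topspace X"
    and dec: "\<And>t x i. x \<in> topspace X \<Longrightarrow> i < n \<Longrightarrow>
      disp (\<Phi> t x) i = (\<Sum>j\<in>J. (\<Sum>l<n. \<gamma> j l * disp x l) * disp (\<Phi> t j) i)"
    using disp_\<Phi>_spanning by blast
  obtain M where M: "\<And>x i. x \<in> topspace X \<Longrightarrow> i < n \<Longrightarrow> \<bar>disp x i\<bar> \<le> M" "M \<ge> 0"
    using disp_bounded by blast
  define d where "d x = (\<Sum>i<n. \<bar>disp x i\<bar>)" for x
  define b where "b x = (\<Sum>i<n. \<Sum>j\<in>J. \<bar>\<Sum>l<n. \<gamma> j l * disp x l\<bar> * M)" for x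
  have d_cont: "continuous_map X euclideanreal d"
    unfolding d_def by (intro continuous_intros continuous_disp) auto
  have b_cont: "continuous_map X euclideanreal b"
    unfolding b_def by (intro continuous_intros continuous_disp J) auto
  have d_le: "d (\<Phi> t x) \<le> b x" if "x \<in> topspace X" for t x
    unfolding d_def b_def
  proof (intro sum_mono)
    fix i assume "i \<in> {..<n}"
    then have i: "i < n" by simp
    have "\<bar>disp (\<Phi> t x) i\<bar> \<le> (\<Sum>j\<in>J. \<bar>(\<Sum>l<n. \<gamma> j l * disp x l) * disp (\<Phi> t j) i\<bar>)"
      unfolding dec[OF that i] by (rule sum_abs)
    also have "\<dots> \<le> (\<Sum>j\<in>J. \<bar>\<Sum>l<n. \<gamma> j l * disp x l\<bar> * M)"
      unfolding abs_mult using J(2) M i \<Phi>_in by (intro sum_mono mult_left_mono) auto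
    finally show "\<bar>disp (\<Phi> t x) i\<bar> \<le> (\<Sum>j\<in>J. \<bar>\<Sum>l<n. \<gamma> j l * disp x l\<bar> * M)" .
  qed
  define K where "K = topspace X - V"
  obtain \<epsilon> where \<epsilon>: "\<epsilon> > 0" "\<And>x. x \<in> K \<Longrightarrow> d x \<ge> \<epsilon>"
  proof (cases "K = {}")
    case True
    then show ?thesis using that[of 1] by simp
  next
    case False
    have "closedin X K" unfolding K_def using assms(1) by (simp add: closedin_diff)
    then have "compactin X K" using compact closedin_compact_space by blast
    then have "compact (d ` K)" using image_compactin[OF _ d_cont] by simp
    then obtain y where y: "y \<in> K" "\<And>x. x \<in> K \<Longrightarrow> d y \<le> d x"
      using compact_attains_inf[of "d ` K"] False by auto
    have "d y \<noteq> 0"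
    proof
      assume "d y = 0"
      then have "\<forall>i<n. disp y i = 0" unfolding d_def by (subst (asm) sum_nonneg_eq_0_iff) auto
      then have "y = x\<^sub>0" using disp_injective y(1) by (auto simp: K_def)
      then show False using y(1) assms(2) by (auto simp: K_def)
    qed
    then have "d y > 0" unfolding d_def by (metis abs_ge_zero order_less_le sum_nonneg)
    then show ?thesis using that y by blast
  qed
  define N where "N = {x \<in> topspace X. b x < \<epsilon>}"
  show ?thesis
  proof
    show "openin X N" unfolding N_def
      using openin_continuous_map_preimage[OF b_cont, of "{..<\<epsilon>}"] by simp
    show "x\<^sub>0 \<in> N" using x0_in \<epsilon> by (simp add: N_def b_def disp_x0)
    show "\<Phi> t x \<in> V" if "x \<in> N" for x t
    proof (rule ccontr)
      assume "\<Phi> t x \<notin> V"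
      then have "\<Phi> t x \<in> K" using that \<Phi>_in by (auto simp: N_def K_def)
      then have "\<epsilon> \<le> d (\<Phi> t x)" by (rule \<epsilon>(2))
      also have "\<dots> \<le> b x" using d_le that by (auto simp: N_def)
      also have "\<dots> < \<epsilon>" using that by (simp add: N_def)
      finally show False by simp
    qed
  qed
qed

section \<open>The linearized flow at the equilibrium\<close>

definition disp' :: "nat \<Rightarrow> 'e \<Rightarrow> 'e \<Rightarrow>\<^sub>L real" where
  "disp' i = (SOME f'. (\<forall>p\<in>\<phi> ` U. ((\<lambda>p. disp (\<psi> p) i) has_derivative blinfun_apply (f' p)) (at p)) \<and>
     continuous_on (\<phi> ` U) f')"

lemma disp'_works:
  assumes "i < n"
  shows disp_has_derivative: "p \<in> \<phi> ` U \<Longrightarrow> ((\<lambda>p. disp (\<psi> p) i) has_derivative blinfun_apply (disp' i p)) (at p)"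
    and continuous_disp': "continuous_on (\<phi> ` U) (disp' i)"
proof -
  have "C1_map X A euclideanreal real_atlas (\<lambda>x. F x i)"
    using embedding assms by (simp add: C1_embedding_def)
  then have "C1_on (\<phi> ` U) (\<lambda>p. F (\<psi> p) i)"
    using C1_map_chartD[OF _ chart, where C = real_atlas and W = UNIV and \<beta> = id] by (simp add: real_atlas_def o_def)
  then obtain f' :: "'e \<Rightarrow> 'e \<Rightarrow>\<^sub>L real"
    where f': "\<And>p. p \<in> \<phi> ` U \<Longrightarrow> ((\<lambda>p. F (\<psi> p) i) has_derivative blinfun_apply (f' p)) (at p)"
      and cont: "continuous_on (\<phi> ` U) f'"
    unfolding C1_on_def by blast
  have "((\<lambda>p. disp (\<psi> p) i) has_derivative blinfun_apply (f' p)) (at p)" if "p \<in> \<phi> ` U" for p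
    unfolding disp_def using has_derivative_diff[OF f'[OF that] has_derivative_const] by simp
  then have "\<exists>f'. (\<forall>p\<in>\<phi> ` U. ((\<lambda>p. disp (\<psi> p) i) has_derivative blinfun_apply (f' p)) (at p)) \<and>
     continuous_on (\<phi> ` U) f'" using cont by blast
  from someI_ex[OF this, folded disp'_def]
  show "p \<in> \<phi> ` U \<Longrightarrow> ((\<lambda>p. disp (\<psi> p) i) has_derivative blinfun_apply (disp' i p)) (at p)"
    and "continuous_on (\<phi> ` U) (disp' i)" by auto
qed

lemma disp'_injective:
  assumes "\<And>i. i < n \<Longrightarrow> disp' i p\<^sub>0 v = 0" shows "v = 0"
proof -
  have "frechet_derivative (\<lambda>p. F (\<psi> p) i) (at p\<^sub>0) = blinfun_apply (disp' i p\<^sub>0)" if "i < n" for i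
  proof -
    have "((\<lambda>p. disp (\<psi> p) i + F x\<^sub>0 i) has_derivative blinfun_apply (disp' i p\<^sub>0)) (at p\<^sub>0)"
      using has_derivative_add[OF disp_has_derivative[OF that p0_in] has_derivative_const] by simp
    then show ?thesis unfolding disp_def using frechet_derivative_at by fastforce
  qed
  then have "chart_differential n F (U, \<phi>) x\<^sub>0 v = chart_differential n F (U, \<phi>) x\<^sub>0 0"
    using assms by (auto simp: chart_differential_def restrict_def)
  moreover have "inj (chart_differential n F (U, \<phi>) x\<^sub>0)"
    using bspec[OF conjunct1[OF conjunct2[OF embedding[unfolded C1_embedding_def]],
          unfolded immersion_def] chart] in_chart by simp
  ultimately show ?thesis by (simp add: inj_eq)
qed

definition chart_flow :: "real \<Rightarrow> 'e \<Rightarrow> 'e" where "chart_flow t p = \<phi> (\<Phi> t (\<psi> p))"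

definition lin_flow :: "real \<Rightarrow> 'e \<Rightarrow> 'e" where "lin_flow t = frechet_derivative (chart_flow t) (at p\<^sub>0)"

lemma chart_flow_p0: "chart_flow t p\<^sub>0 = p\<^sub>0"
  using in_chart by (simp add: chart_flow_def \<psi>_\<phi> \<Phi>_x0)

text \<open>
  Differentiability of \<open>\<Phi>\<close> is given jointly in \<open>(t, x)\<close>, in the product chart; restricting to the slice
  of constant \<open>t\<close> gives that of the time-\<open>t\<close> map.
\<close>

lemma chart_flow_has_derivative: "(chart_flow t has_derivative lin_flow t) (at p\<^sub>0)"
proof -
  let ?f = "\<phi> \<circ> (\<lambda>(t, x). \<Phi> t x) \<circ> inv_into (UNIV \<times> U) (map_prod id \<phi>)"
  have prod_chart: "(UNIV \<times> U, map_prod id \<phi>) \<in> prod_atlas real_atlas A"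
    using chart by (force simp: prod_atlas_def real_atlas_def)
  have "C1_map (prod_topology euclideanreal X) (prod_atlas real_atlas A) X A (\<lambda>(t, x). \<Phi> t x)"
    using flow by (simp add: C1_flow_def)
  from C1_map_chartD[OF this prod_chart chart] have "C1_on (map_prod id \<phi> ` {x \<in> UNIV \<times> U. (\<lambda>(t, x). \<Phi> t x) x \<in> U}) ?f"
    .
  moreover have "(t, p\<^sub>0) \<in> map_prod id \<phi> ` {x \<in> UNIV \<times> U. (\<lambda>(t, x). \<Phi> t x) x \<in> U}"
    using in_chart \<Phi>_x0 by (intro image_eqI[of _ _ "(t, x\<^sub>0)"]) auto
  ultimately have "\<exists>f'. (?f has_derivative f') (at (t, p\<^sub>0))"
    by (rule C1_on_imp_has_derivative)
  then obtain f' where f': "(?f has_derivative f') (at (t, p\<^sub>0))" ..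
  have "((\<lambda>p. (t, p)) has_derivative (\<lambda>v. (0, v))) (at p\<^sub>0)"
    by (auto intro!: derivative_eq_intros)
  from has_derivative_compose[OF this f']
  have der: "((\<lambda>p. ?f (t, p)) has_derivative (\<lambda>v. f' (0, v))) (at p\<^sub>0)" .
  have "inj_on (map_prod id \<phi>) (UNIV \<times> U)" using inj_\<phi> by (auto simp: inj_on_def)
  then have inv: "inv_into (UNIV \<times> U) (map_prod id \<phi>) (t, \<phi> x) = (t, x)" if "x \<in> U" for x
    using inv_into_f_f[of "map_prod id \<phi>" "UNIV \<times> U" "(t, x)"] that by simp
  have "?f (t, p) = chart_flow t p" if "p \<in> \<phi> ` U" for p
    using inv[OF \<psi>_in[OF that]] by (simp add: \<phi>_\<psi>[OF that] chart_flow_def)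
  then have "(chart_flow t has_derivative (\<lambda>v. f' (0, v))) (at p\<^sub>0)"
    using has_derivative_transform_within_open[OF der open_image p0_in] by blast
  then show ?thesis unfolding lin_flow_def using frechet_derivative_works differentiableI by blast
qed

lemma eventually_in_chart: "\<forall>\<^sub>F p in nhds p\<^sub>0. p \<in> \<phi> ` U \<and> \<Phi> t (\<psi> p) \<in> U"
proof -
  have "openin X {x \<in> topspace X. \<Phi> t x \<in> U}"
    using openin_continuous_map_preimage[OF continuous_\<Phi> open_U] .
  from open_preimage_\<psi>[OF this]
  have "open {p \<in> \<phi> ` U. \<psi> p \<in> {x \<in> topspace X. \<Phi> t x \<in> U}}" .
  moreover have "p\<^sub>0 \<in> {p \<in> \<phi> ` U. \<psi> p \<in> {x \<in> topspace X. \<Phi> t x \<in> U}}"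
    using p0_in in_chart x0_in by (simp add: \<psi>_\<phi> \<Phi>_x0)
  ultimately show ?thesis
    by (auto intro: eventually_mono[OF eventually_nhds_in_open])
qed

lemma \<psi>_chart_flow: "\<Phi> t (\<psi> p) \<in> U \<Longrightarrow> \<psi> (chart_flow t p) = \<Phi> t (\<psi> p)"
  by (simp add: chart_flow_def \<psi>_\<phi>)

lemma lin_flow_linear: "linear (lin_flow t)"
  using chart_flow_has_derivative has_derivative_linear by blast

lemma lin_flow_0: "lin_flow 0 v = v"
proof -
  have "lin_flow 0 = (\<lambda>v. v)"
    by (rule has_derivative_unique_eventually[OF chart_flow_has_derivative has_derivative_ident],
        rule eventually_mono[OF eventually_in_chart[of 0]])
      (auto simp: chart_flow_def \<Phi>_0 \<psi>_in_X \<phi>_\<psi>)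
  then show ?thesis by simp
qed

lemma lin_flow_add: "lin_flow (s + t) v = lin_flow s (lin_flow t v)"
proof -
  have "(chart_flow s has_derivative lin_flow s) (at (chart_flow t p\<^sub>0))" by (simp add: chart_flow_p0 chart_flow_has_derivative)
  from has_derivative_compose[OF chart_flow_has_derivative this]
  have "((\<lambda>p. chart_flow s (chart_flow t p)) has_derivative (\<lambda>v. lin_flow s (lin_flow t v))) (at p\<^sub>0)" .
  then have "lin_flow (s + t) = (\<lambda>v. lin_flow s (lin_flow t v))"
  proof (rule has_derivative_unique_eventually[OF chart_flow_has_derivative])
    show "\<forall>\<^sub>F p in nhds p\<^sub>0. chart_flow (s + t) p = chart_flow s (chart_flow t p)"
    proof (rule eventually_mono[OF eventually_in_chart[of t]])
      fix p assume p: "p \<in> \<phi> ` U \<and> \<Phi> t (\<psi> p) \<in> U"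
      then have "chart_flow s (chart_flow t p) = \<phi> (\<Phi> s (\<Phi> t (\<psi> p)))"
        using \<psi>_chart_flow[of t p] by (simp add: chart_flow_def[of s])
      then show "chart_flow (s + t) p = chart_flow s (chart_flow t p)"
        using p by (simp add: chart_flow_def \<Phi>_add \<psi>_in_X)
    qed
  qed
  then show ?thesis by simp
qed

text \<open>
  Differentiating the expansion of the displacement in \<open>x\<close> expresses \<open>lin_flow t\<close> through finitely many
  orbits; its boundedness and continuity in \<open>t\<close> follow from this formula.
\<close>

lemma disp'_lin_flow:
  assumes dec: "\<And>t x i. x \<in> topspace X \<Longrightarrow> i < n \<Longrightarrow>
      disp (\<Phi> t x) i = (\<Sum>j\<in>J. (\<Sum>l<n. \<gamma> j l * disp x l) * disp (\<Phi> t j) i)"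
    and "i < n"
  shows "disp' i p\<^sub>0 (lin_flow t v) = (\<Sum>j\<in>J. (\<Sum>l<n. \<gamma> j l * disp' l p\<^sub>0 v) * disp (\<Phi> t j) i)"
proof -
  have "((\<lambda>p. disp (\<psi> p) i) has_derivative blinfun_apply (disp' i p\<^sub>0)) (at (chart_flow t p\<^sub>0))"
    using disp_has_derivative[OF \<open>i < n\<close> p0_in] by (simp add: chart_flow_p0)
  from has_derivative_compose[OF chart_flow_has_derivative this]
  have "((\<lambda>p. disp (\<psi> (chart_flow t p)) i) has_derivative (\<lambda>v. disp' i p\<^sub>0 (lin_flow t v))) (at p\<^sub>0)" .
  moreover have "((\<lambda>p. \<Sum>j\<in>J. (\<Sum>l<n. \<gamma> j l * disp (\<psi> p) l) * disp (\<Phi> t j) i) has_derivative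
     (\<lambda>v. \<Sum>j\<in>J. (\<Sum>l<n. \<gamma> j l * disp' l p\<^sub>0 v) * disp (\<Phi> t j) i)) (at p\<^sub>0)"
    by (intro has_derivative_sum has_derivative_mult_left has_derivative_mult_right
        disp_has_derivative p0_in) auto
  ultimately have "(\<lambda>v. disp' i p\<^sub>0 (lin_flow t v)) =
     (\<lambda>v. \<Sum>j\<in>J. (\<Sum>l<n. \<gamma> j l * disp' l p\<^sub>0 v) * disp (\<Phi> t j) i)"
  proof (rule has_derivative_unique_eventually)
    show "\<forall>\<^sub>F p in nhds p\<^sub>0. disp (\<psi> (chart_flow t p)) i = (\<Sum>j\<in>J. (\<Sum>l<n. \<gamma> j l * disp (\<psi> p) l) * disp (\<Phi> t j) i)"
    proof (rule eventually_mono[OF eventually_in_chart[of t]])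
      fix p assume p: "p \<in> \<phi> ` U \<and> \<Phi> t (\<psi> p) \<in> U"
      then show "disp (\<psi> (chart_flow t p)) i = (\<Sum>j\<in>J. (\<Sum>l<n. \<gamma> j l * disp (\<psi> p) l) * disp (\<Phi> t j) i)"
        using dec[OF \<psi>_in_X \<open>i < n\<close>] by (simp add: \<psi>_chart_flow)
    qed
  qed
  then show ?thesis by metis
qed

lemma continuous_disp_orbit: "x \<in> topspace X \<Longrightarrow> i < n \<Longrightarrow> continuous_on UNIV (\<lambda>t. disp (\<Phi> t x) i)"
  using continuous_map_compose[OF continuous_orbit continuous_disp] by (simp add: o_def)

section \<open>Local linearization and the theorem\<close>

text \<open>
  The linear map \<open>d \<mapsto> \<Sum>l. d l u l\<close> from \<open>\<real>\<^sup>n\<close> to the model space is a left inverse of the differential of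
  \<open>F\<close> that intertwines the flow, acting on displacements, with the linearized flow. As in the proof
  of Maschke's theorem, it arises from an arbitrary left inverse, given by \<open>e\<close>, by averaging.
\<close>

lemma local_linearization:
  obtains C u where
    "\<And>t v. norm (lin_flow t v) \<le> C * norm v"
    "\<And>v. continuous_on UNIV (\<lambda>t. lin_flow t v)"
    "\<And>t x. x \<in> topspace X \<Longrightarrow> (\<Sum>l<n. disp (\<Phi> t x) l *\<^sub>R u l) = lin_flow t (\<Sum>l<n. disp x l *\<^sub>R u l)"
    "\<And>v. (\<Sum>l<n. disp' l p\<^sub>0 v *\<^sub>R u l) = v"
proof -
  obtain J \<gamma> where J: "finite J" "J \<subseteq> topspace X"
    and dec: "\<And>t x i. x \<in> topspace X \<Longrightarrow> i < n \<Longrightarrow>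
      disp (\<Phi> t x) i = (\<Sum>j\<in>J. (\<Sum>l<n. \<gamma> j l * disp x l) * disp (\<Phi> t j) i)"
    using disp_\<Phi>_spanning by blast
  obtain M where M: "\<And>x i. x \<in> topspace X \<Longrightarrow> i < n \<Longrightarrow> \<bar>disp x i\<bar> \<le> M" "M \<ge> 0"
    using disp_bounded by blast
  obtain e where e: "\<And>v. (\<Sum>i<n. disp' i p\<^sub>0 v *\<^sub>R e i) = v"
    using jointly_injective_left_inverse[of n "\<lambda>i. blinfun_apply (disp' i p\<^sub>0)"] disp'_injective
    by (auto simp: bounded_linear.linear[OF blinfun.bounded_linear_right])
  define a where "a j v = (\<Sum>l<n. \<gamma> j l * disp' l p\<^sub>0 v)" for j v
  define c where "c x j = (\<Sum>l<n. \<gamma> j l * disp x l)" for x j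
  define \<xi> where "\<xi> x = (\<Sum>i<n. disp x i *\<^sub>R e i)" for x
  have lin_flow_eq: "(\<Sum>j\<in>J. a j v *\<^sub>R \<xi> (\<Phi> t j)) = lin_flow t v" for t v
  proof -
    have "lin_flow t v = (\<Sum>i<n. (\<Sum>j\<in>J. a j v * disp (\<Phi> t j) i) *\<^sub>R e i)"
      by (subst e[symmetric, of "lin_flow t v"]) (simp add: disp'_lin_flow[OF dec] a_def)
    also have "\<dots> = (\<Sum>j\<in>J. a j v *\<^sub>R \<xi> (\<Phi> t j))"
      unfolding \<xi>_def scaleR_sum_left scaleR_sum_right by (subst sum.swap) simp
    finally show ?thesis ..
  qed
  have \<xi>_cont: "continuous_on UNIV (\<lambda>t. \<xi> (\<Phi> t x))" if "x \<in> topspace X" for x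
    unfolding \<xi>_def by (intro continuous_intros continuous_disp_orbit that) auto
  define K where "K = (\<Sum>i<n. M * norm (e i))"
  have \<xi>_bd: "norm (\<xi> x) \<le> K" if "x \<in> topspace X" for x
    unfolding \<xi>_def K_def
    by (rule order_trans[OF norm_sum]) (auto intro!: sum_mono mult_right_mono M that)
  have "K \<ge> 0" unfolding K_def using M by (intro sum_nonneg) auto
  have cont: "continuous_on UNIV (\<lambda>t. lin_flow t v)" for v
    unfolding lin_flow_eq[symmetric] using J by (intro continuous_intros \<xi>_cont) auto
  define C where "C = (\<Sum>j\<in>J. (\<Sum>l<n. \<bar>\<gamma> j l\<bar> * norm (disp' l p\<^sub>0)) * K)"
  have bd: "norm (lin_flow t v) \<le> C * norm v" for t v
  proof -
    have a: "\<bar>a j v\<bar> \<le> (\<Sum>l<n. \<bar>\<gamma> j l\<bar> * norm (disp' l p\<^sub>0)) * norm v" for j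
    proof -
      have "\<bar>disp' l p\<^sub>0 v\<bar> \<le> norm (disp' l p\<^sub>0) * norm v" for l
        using norm_blinfun[of "disp' l p\<^sub>0" v] by simp
      then have "\<bar>a j v\<bar> \<le> (\<Sum>l<n. \<bar>\<gamma> j l\<bar> * (norm (disp' l p\<^sub>0) * norm v))"
        unfolding a_def
        by (intro order_trans[OF sum_abs] sum_mono) (auto simp: abs_mult intro!: mult_left_mono)
      then show ?thesis by (simp add: sum_distrib_right mult.assoc)
    qed
    have "norm (lin_flow t v) \<le> (\<Sum>j\<in>J. \<bar>a j v\<bar> * norm (\<xi> (\<Phi> t j)))"
      unfolding lin_flow_eq[symmetric] by (rule order_trans[OF norm_sum]) simp
    also have "\<dots> \<le> (\<Sum>j\<in>J. ((\<Sum>l<n. \<bar>\<gamma> j l\<bar> * norm (disp' l p\<^sub>0)) * norm v) * K)"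
      using J \<xi>_bd \<Phi>_in by (intro sum_mono mult_mono a) (auto intro!: mult_nonneg_nonneg sum_nonneg)
    also have "\<dots> = C * norm v"
      unfolding C_def sum_distrib_right[of _ J] by (intro sum.cong) (simp_all add: mult_ac)
    finally show ?thesis .
  qed
  have \<xi>_dec: "\<xi> (\<Phi> t x) = (\<Sum>j\<in>J. c x j *\<^sub>R \<xi> (\<Phi> t j))" if "x \<in> topspace X" for t x
  proof -
    have "\<xi> (\<Phi> t x) = (\<Sum>i<n. (\<Sum>j\<in>J. c x j * disp (\<Phi> t j) i) *\<^sub>R e i)"
      unfolding \<xi>_def by (simp add: dec[OF that] c_def)
    also have "\<dots> = (\<Sum>j\<in>J. c x j *\<^sub>R \<xi> (\<Phi> t j))"
      unfolding \<xi>_def scaleR_sum_left scaleR_sum_right by (subst sum.swap) simp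
    finally show ?thesis .
  qed
  obtain w where w:
    "\<And>s x. x \<in> topspace X \<Longrightarrow> (\<Sum>j\<in>J. c (\<Phi> s x) j *\<^sub>R w j) = lin_flow s (\<Sum>j\<in>J. c x j *\<^sub>R w j)"
    "\<And>a v. (\<And>t. (\<Sum>j\<in>J. a j *\<^sub>R \<xi> (\<Phi> t j)) = lin_flow t v) \<Longrightarrow> (\<Sum>j\<in>J. a j *\<^sub>R w j) = v"
    using equivariant_average[OF flow_on lin_flow_linear lin_flow_0 lin_flow_add bd cont J
        \<xi>_cont \<xi>_bd \<xi>_dec]
    by blast
  define u where "u l = (\<Sum>j\<in>J. \<gamma> j l *\<^sub>R w j)" for l
  have u: "(\<Sum>l<n. b l *\<^sub>R u l) = (\<Sum>j\<in>J. (\<Sum>l<n. \<gamma> j l * b l) *\<^sub>R w j)" for b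
    unfolding u_def scaleR_sum_left scaleR_sum_right by (subst sum.swap) (simp add: mult.commute)
  show ?thesis
  proof
    show "norm (lin_flow t v) \<le> C * norm v" for t v by (rule bd)
    show "continuous_on UNIV (\<lambda>t. lin_flow t v)" for v by (rule cont)
    show "(\<Sum>l<n. disp (\<Phi> t x) l *\<^sub>R u l) = lin_flow t (\<Sum>l<n. disp x l *\<^sub>R u l)" if "x \<in> topspace X" for t x
      using w(1)[OF that] by (simp add: u c_def)
    show "(\<Sum>l<n. disp' l p\<^sub>0 v *\<^sub>R u l) = v" for v
      using w(2)[OF lin_flow_eq] by (simp add: u a_def)
  qed
qed

text \<open>
  The equivariant map \<open>h\<close> takes the value \<open>s v\<close> at a point \<open>z\<close> near \<open>x\<^sub>0\<close>, and it takes the same value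
  on the whole orbit of \<open>z\<close>, which stays where \<open>h\<close> is injective.
\<close>

lemma fixed_vector_imp_not_isolated:
  assumes v: "v \<noteq> 0" "\<And>t. lin_flow t v = v"
  shows "\<not> isolated_equilibrium X \<Phi> x\<^sub>0"
proof
  assume "isolated_equilibrium X \<Phi> x\<^sub>0"
  then obtain W where W: "openin X W" "W \<inter> equilibria X \<Phi> = {x\<^sub>0}"
    by (auto simp: isolated_equilibrium_def)
  obtain u where equi: "\<And>t x. x \<in> topspace X \<Longrightarrow>
      (\<Sum>l<n. disp (\<Phi> t x) l *\<^sub>R u l) = lin_flow t (\<Sum>l<n. disp x l *\<^sub>R u l)"
    and u: "\<And>v. (\<Sum>l<n. disp' l p\<^sub>0 v *\<^sub>R u l) = v"
    by (rule local_linearization, rule that)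
  define h where "h x = (\<Sum>l<n. disp x l *\<^sub>R u l)" for x
  define k' where "k' p = (\<Sum>l<n. blinfun_scaleR_left (u l) o\<^sub>L disp' l p)" for p
  have k': "((h \<circ> \<psi>) has_derivative blinfun_apply (k' p)) (at p)" if "p \<in> \<phi> ` U" for p
  proof -
    have "((\<lambda>p. \<Sum>l<n. disp (\<psi> p) l *\<^sub>R u l) has_derivative (\<lambda>v. \<Sum>l<n. disp' l p v *\<^sub>R u l)) (at p)"
      by (intro has_derivative_sum has_derivative_scaleR_left disp_has_derivative that) auto
    moreover have "blinfun_apply (k' p) = (\<lambda>v. \<Sum>l<n. disp' l p v *\<^sub>R u l)"
      by (simp add: k'_def blinfun.sum_left fun_eq_iff)
    ultimately show ?thesis by (simp add: h_def o_def)
  qed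
  have cont: "continuous_on (\<phi> ` U) k'"
    unfolding k'_def by (intro continuous_intros continuous_disp') auto
  have "id_blinfun o\<^sub>L k' p\<^sub>0 = id_blinfun"
    by (rule blinfun_eqI) (simp add: k'_def blinfun.sum_left u)
  from inverse_function_theorem[OF open_image k' cont p0_in this]
  obtain U' V g where U': "open U'" "U' \<subseteq> \<phi> ` U" "p\<^sub>0 \<in> U'"
    and V: "open V" "(h \<circ> \<psi>) p\<^sub>0 \<in> V" and hom: "homeomorphism U' V (h \<circ> \<psi>) g" by metis
  have "openin X (\<psi> ` U' \<inter> W)" using open_image_\<psi>[OF U'(1,2)] W(1) by blast
  moreover have "x\<^sub>0 \<in> \<psi> ` U' \<inter> W"
    using U'(3) W(2) \<psi>_\<phi>[OF in_chart] by (metis IntI Int_iff image_eqI singletonI)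
  ultimately obtain N where N: "openin X N" "x\<^sub>0 \<in> N" "\<And>x t. x \<in> N \<Longrightarrow> \<Phi> t x \<in> \<psi> ` U' \<inter> W"
    using orbits_stay_close by metis
  \<comment> \<open>Points of \<open>P\<close> lie in the injectivity domain of \<open>h \<circ> \<psi>\<close>, together with their orbits.\<close>
  define P where "P = U' \<inter> {p \<in> \<phi> ` U. \<psi> p \<in> N}"
  have P: "open P" "p\<^sub>0 \<in> P" "P \<subseteq> U'"
    using U' N open_preimage_\<psi>[OF N(1)] p0_in by (auto simp: P_def \<psi>_\<phi> in_chart)
  have "openin (top_of_set V) ((h \<circ> \<psi>) ` P)"
    using homeomorphism_imp_open_map[OF hom, of P] P by (simp add: open_subset)
  then have "open ((h \<circ> \<psi>) ` P)" using V(1) openin_open_trans by blast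
  moreover have "h x\<^sub>0 = 0" by (simp add: h_def disp_x0)
  then have "0 \<in> (h \<circ> \<psi>) ` P"
    using P(2) in_chart by (intro image_eqI[of _ _ p\<^sub>0]) (auto simp: \<psi>_\<phi>)
  ultimately obtain r where r: "r > 0" "ball 0 r \<subseteq> (h \<circ> \<psi>) ` P"
    using open_contains_ball by metis
  define s where "s = r / (2 * norm v)"
  have "s > 0" "s *\<^sub>R v \<in> ball 0 r" using r(1) v(1) by (auto simp: s_def)
  then obtain p where p: "p \<in> P" "h (\<psi> p) = s *\<^sub>R v" using r(2) by fastforce
  define z where "z = \<psi> p"
  have z: "z \<in> N" "z \<in> topspace X" "h z = s *\<^sub>R v"
    using p openin_subset[OF N(1)] by (auto simp: P_def z_def)
  have "\<Phi> t z = z" for t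
  proof -
    obtain q where q: "q \<in> U'" "\<Phi> t z = \<psi> q" using N(3)[OF z(1), of t] by blast
    have "h (\<psi> q) = lin_flow t (h z)" using equi[OF z(2), of t] by (simp add: h_def q(2)[symmetric])
    also have "\<dots> = h (\<psi> p)"
      using v(2) linear_cmul[OF lin_flow_linear] p(2) by (simp add: z(3))
    finally have "q = p"
      using hom q(1) p(1) P(3) unfolding homeomorphism_def by (metis comp_apply subsetD)
    then show ?thesis using q(2) by (simp add: z_def)
  qed
  then have "z \<in> equilibria X \<Phi>" using z(2) by (simp add: equilibria_def)
  moreover have "z \<in> W" using N(3)[OF z(1), of 0] z(2) by (simp add: \<Phi>_0)
  ultimately have "z = x\<^sub>0" using W(2) by blast
  then show False using z(3) \<open>h x\<^sub>0 = 0\<close> \<open>s > 0\<close> v(1) by simp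
qed

end

theorem corollary1:
  fixes X :: "'a topology"
    and A :: "('a, real ^ 'n) chart set"
    and \<Phi> :: "real \<Rightarrow> 'a \<Rightarrow> 'a"
  assumes "C1_manifold X A"
    and "odd CARD('n)"
    and "connected_space X"
    and "compact_space X"
    and "C1_flow X A \<Phi>"
    and "\<exists>x. isolated_equilibrium X \<Phi> x"
  shows "\<not> linearizable_by_C1_embedding X A \<Phi>"
proof
  assume "linearizable_by_C1_embedding X A \<Phi>"
  then obtain n F where F: "linearizing X \<Phi> n F" "C1_embedding X A n F"
    by (auto simp: linearizable_by_C1_embedding_def)
  obtain x\<^sub>0 where x0: "isolated_equilibrium X \<Phi> x\<^sub>0" using assms(6) by blast
  then have eq: "x\<^sub>0 \<in> equilibria X \<Phi>" by (simp add: isolated_equilibrium_def)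
  have atlas: "C1_atlas X A" using assms(1) by (simp add: C1_manifold_def)
  have "x\<^sub>0 \<in> (\<Union>(U, \<phi>)\<in>A. U)"
    using atlas eq by (simp add: C1_atlas_def equilibria_def)
  then obtain U \<phi> where U: "(U, \<phi>) \<in> A" "x\<^sub>0 \<in> U" by auto
  interpret linearized_equilibrium X A \<Phi> n F x\<^sub>0 U \<phi>
    using atlas assms(4,5) F eq U by unfold_locales
  obtain C where C: "\<And>t v. norm (lin_flow t v) \<le> C * norm v" "\<And>v. continuous_on UNIV (\<lambda>t. lin_flow t v)"
    by (rule local_linearization, rule that)
  obtain v where "v \<noteq> 0" "\<And>t. lin_flow t v = v"
    using bounded_linear_group_odd_dimension_fixed_vector[OF assms(2) lin_flow_linear lin_flow_0 lin_flow_add C]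
    by blast
  then show False using fixed_vector_imp_not_isolated x0 by blast
qed

end
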